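(* Let $\Delta\neq\mathbb{N}$ be a numerical semigroup, let $d\ge2$ be an integer, and let $a\in\Delta\setminus\{0\}$ with $a+1\in\Delta$. Set $\Delta_d(a)=d\Delta\cup\bigcup_{i=1}^{d-1}(da+i+d\Delta)$, which is a numerical semigroup. Then $$m(\Delta_d(a))=d\,m(\Delta),$$ $$\operatorname{F}(\Delta_d(a))=d\operatorname{F}(\Delta)+da+d-1,$$ $$\operatorname{g}(\Delta_d(a))=d\operatorname{g}(\Delta)+(d-1)a,$$ $$\operatorname{n}(\Delta_d(a))=d\operatorname{n}(\Delta)+a,$$ $$\operatorname{e}(\Delta_d(a))=\operatorname{e}(\Delta)+d-1.$$
   Context: $\mathbb{N}=\{0,1,2,\dots\}$. A numerical semigroup is a submonoid of $(\mathbb{N},+)$ with finite complement in $\mathbb{N}$. For a numerical semigroup $S$: $m(S)=\min(S\setminus\{0\})$ (multiplicity), $\operatorname{F}(S)=\max(\mathbb{Z}\setminus S)$ (Frobenius number), $\operatorname{g}(S)=|\mathbb{N}\setminus S|$ (genus), $\operatorname{n}(S)=|\{s\in S: s<\operatorname{F}(S)\}|$, and $\operatorname{e}(S)$ (embedding dimension) is the cardinality of the unique minimal system of generators of $S$. $dA=\{dx: x\in A\}$ and $k+A=\{k+x:x\in A\}$ for $A\subseteq\mathbb{N}$ and $k\in\mathbb{N}$. *)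

theory Defs
  imports Complex_Main
begin

definition submonoid_nat :: "nat set \<Rightarrow> bool" where
  "submonoid_nat S \<longleftrightarrow> 0 \<in> S \<and> (\<forall>x\<in>S. \<forall>y\<in>S. x + y \<in> S)"

definition numerical_semigroup :: "nat set \<Rightarrow> bool" where
  "numerical_semigroup S \<longleftrightarrow> submonoid_nat S \<and> finite (UNIV - S)"

definition multiplicity_ns :: "nat set \<Rightarrow> nat" where
  "multiplicity_ns S = (LEAST s. s \<in> S - {0})"

text \<open>The maximum is taken in the integers, so that the value for the semigroup of all naturals
  is -1. The complement is infinite below, hence \<open>GREATEST\<close> rather than \<open>Max\<close>.\<close>

definition frobenius :: "nat set \<Rightarrow> int" where
  "frobenius S = (GREATEST z. z \<in> UNIV - int ` S)"

definition genus :: "nat set \<Rightarrow> nat" where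
  "genus S = card (UNIV - S)"

definition n_small :: "nat set \<Rightarrow> nat" where
  "n_small S = card {s \<in> S. int s < frobenius S}"

definition minimal_generators :: "nat set \<Rightarrow> nat set \<Rightarrow> bool" where
  "minimal_generators S A \<longleftrightarrow>
     submonoid_nat hull A = S \<and> (\<forall>B. B \<subset> A \<longrightarrow> submonoid_nat hull B \<noteq> S)"

text \<open>Every numerical semigroup has exactly one minimal system of generators, and it is finite;
  for such sets the description below is therefore proper.\<close>

definition embedding_dim :: "nat set \<Rightarrow> nat" where
  "embedding_dim S = card (THE A. minimal_generators S A)"

definition dilate :: "nat \<Rightarrow> nat set \<Rightarrow> nat set" where
  "dilate d A = (\<lambda>x. d * x) ` A"

definition translate :: "nat \<Rightarrow> nat set \<Rightarrow> nat set" where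
  "translate k A = (\<lambda>x. k + x) ` A"

definition Delta_ext :: "nat set \<Rightarrow> nat \<Rightarrow> nat \<Rightarrow> nat set" where
  "Delta_ext \<Delta> d a = dilate d \<Delta> \<union> (\<Union>i\<in>{1..d - 1}. translate (d * a + i) (dilate d \<Delta>))"

end

theory Submission
  imports Defs
begin

text \<open>Writing elements of \<open>\<nat>\<close> as \<open>d * q + i\<close> with \<open>i < d\<close>, the semigroup \<open>\<Delta>\<^sub>d(a)\<close> consists of the numbers
  with \<open>q \<in> \<Delta>\<close> in the residue class \<open>i = 0\<close>, and \<open>q \<in> a + \<Delta>\<close> in every other class. The carry in
  a sum of two residues is absorbed by \<open>a + 1 \<in> \<Delta>\<close>. Genus and Frobenius number are read off class
  by class, and \<open>n\<close> follows from \<open>n + g = F + 1\<close>. The minimal system of generators of a numerical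
  semigroup is its set of atoms (nonzero elements that are not a sum of two nonzero elements);
  the atoms of \<open>\<Delta>\<^sub>d(a)\<close> are \<open>d\<close> times the atoms of \<open>\<Delta>\<close> together with the numbers \<open>d * a + i\<close>,
  \<open>1 \<le> i < d\<close>.\<close>

section \<open>Invariants of numerical semigroups\<close>

lemma submonoid_natD:
  assumes "submonoid_nat S"
  shows "0 \<in> S" and "x \<in> S \<Longrightarrow> y \<in> S \<Longrightarrow> x + y \<in> S"
  using assms by (auto simp: submonoid_nat_def)

lemma frobenius_eqI:
  assumes "f \<notin> S" and "\<And>x. f < x \<Longrightarrow> x \<in> S"
  shows "frobenius S = int f"
  unfolding frobenius_def
proof (rule Greatest_equality)
  show "int f \<in> UNIV - int ` S" using assms(1) by auto
next
  fix z assume z: "z \<in> UNIV - int ` S"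
  show "z \<le> int f"
  proof (rule ccontr)
    assume "\<not> z \<le> int f"
    then have "f < nat z" and "z = int (nat z)" by auto
    then have "z \<in> int ` S" using assms(2) by blast
    then show False using z by simp
  qed
qed

text \<open>With \<open>S \<noteq> UNIV\<close> there is a gap among the naturals, so the integer
  maximum defining \<open>frobenius\<close> can be replaced by a natural number
  \<open>f\<close>.\<close>

lemma numerical_semigroup_largest_gap:
  assumes "numerical_semigroup S" and "S \<noteq> UNIV"
  obtains f where "f \<notin> S" and "\<And>x. f < x \<Longrightarrow> x \<in> S"
proof
  have fin: "finite (UNIV - S)" and ne: "UNIV - S \<noteq> {}"
    using assms by (auto simp: numerical_semigroup_def)
  show "Max (UNIV - S) \<notin> S" using Max_in[OF fin ne] by simp
  show "x \<in> S" if "Max (UNIV - S) < x" for x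
    using Max_ge[OF fin, of x] that by force
qed

text \<open>As \<open>f\<close> is the largest gap, the \<open>f + 1\<close> numbers up to
  \<open>f\<close> are divided between the elements below \<open>f\<close> and the gaps.\<close>

lemma n_small_plus_genus:
  assumes "f \<notin> S" and "\<And>x. f < x \<Longrightarrow> x \<in> S"
  shows "n_small S + genus S = f + 1"
proof -
  have n: "{s \<in> S. int s < frobenius S} = {s \<in> S. s < f}"
    using frobenius_eqI[OF assms] by simp
  have gaps: "UNIV - S \<subseteq> {..f}" using assms(2) by (meson DiffD2 atMost_iff not_le subsetI)
  have "x \<in> S \<and> x < f \<or> x \<notin> S \<longleftrightarrow> x \<le> f" for x
    using assms(1) assms(2)[of x] by (cases x f rule: linorder_cases) auto
  then have "{s \<in> S. s < f} \<union> (UNIV - S) = {..f}" by blast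
  moreover have "card ({s \<in> S. s < f} \<union> (UNIV - S)) = card {s \<in> S. s < f} + card (UNIV - S)"
    by (rule card_Un_disjoint) (use finite_subset[OF gaps finite_atMost] in auto)
  ultimately show ?thesis by (simp add: n_small_def genus_def n)
qed

lemma multiplicity_ns_mem:
  assumes "x \<in> S - {0}"
  shows "multiplicity_ns S \<in> S - {0}" and "multiplicity_ns S \<le> x"
  unfolding multiplicity_ns_def using assms by (rule LeastI, rule Least_le)

section \<open>Atoms\<close>

definition atoms :: "nat set \<Rightarrow> nat set" where
  "atoms S = {x \<in> S - {0}. \<forall>y\<in>S - {0}. \<forall>z\<in>S - {0}. x \<noteq> y + z}"

lemma atoms_irreducible:
  "x \<in> atoms S \<Longrightarrow> y \<in> S - {0} \<Longrightarrow> z \<in> S - {0} \<Longrightarrow> x \<noteq> y + z"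
  by (auto simp: atoms_def)

lemma submonoid_nat_hull: "submonoid_nat (submonoid_nat hull A)"
  by (rule hull_in) (simp add: submonoid_nat_def)

text \<open>Strong induction: a nonzero element that is not an atom splits into two nonzero, hence
  smaller, elements.\<close>

lemma hull_atoms:
  assumes S: "submonoid_nat S"
  shows "submonoid_nat hull (atoms S) = S"
proof
  show "submonoid_nat hull (atoms S) \<subseteq> S"
    by (rule hull_minimal) (use S in \<open>auto simp: atoms_def\<close>)
  show "S \<subseteq> submonoid_nat hull (atoms S)"
  proof
    fix x assume "x \<in> S"
    then show "x \<in> submonoid_nat hull (atoms S)"
    proof (induction x rule: less_induct)
      case (less x)
      show ?case
      proof (cases "x = 0 \<or> x \<in> atoms S")
        case True
        then show ?thesis using submonoid_natD(1)[OF submonoid_nat_hull] hull_inc by metis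
      next
        case False
        then obtain y z where "y \<in> S - {0}" "z \<in> S - {0}" "x = y + z"
          using less.prems unfolding atoms_def by blast
        then show ?thesis
          using less.IH[of y] less.IH[of z] submonoid_natD(2)[OF submonoid_nat_hull] by simp
      qed
    qed
  qed
qed

text \<open>Removing an atom from \<open>S\<close> leaves a submonoid, so no generating set can omit one.\<close>

lemma atoms_subset_generators:
  assumes A: "submonoid_nat hull A = S"
  shows "atoms S \<subseteq> A"
proof
  fix x assume x: "x \<in> atoms S"
  show "x \<in> A"
  proof (rule ccontr)
    assume "x \<notin> A"
    have S: "submonoid_nat S" using submonoid_nat_hull[of A] A by simp
    have "submonoid_nat (S - {x})"
      unfolding submonoid_nat_def
    proof (intro conjI ballI)
      show "0 \<in> S - {x}" using x submonoid_natD(1)[OF S] by (auto simp: atoms_def)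
    next
      fix y z assume "y \<in> S - {x}" "z \<in> S - {x}"
      then show "y + z \<in> S - {x}"
        using x submonoid_natD(2)[OF S, of y z] by (cases "y = 0 \<or> z = 0") (auto simp: atoms_def)
    qed
    moreover have "A \<subseteq> S - {x}" using hull_subset[of A submonoid_nat] A \<open>x \<notin> A\<close> by auto
    ultimately have "S \<subseteq> S - {x}" using hull_minimal[of A "S - {x}" submonoid_nat] A by blast
    then show False using x by (auto simp: atoms_def)
  qed
qed

text \<open>The atoms generate \<open>S\<close> and lie in every generating set, so minimality
  excludes everything else. This supplies the uniqueness that \<open>THE\<close> in
  \<open>embedding_dim\<close> requires.\<close>

lemma minimal_generators_iff_atoms:
  assumes "submonoid_nat S"
  shows "minimal_generators S A \<longleftrightarrow> A = atoms S"
  unfolding minimal_generators_def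
  using hull_atoms[OF assms] atoms_subset_generators[of _ S] by blast

lemma embedding_dim_eq_card_atoms:
  assumes "submonoid_nat S"
  shows "embedding_dim S = card (atoms S)"
  by (simp add: embedding_dim_def minimal_generators_iff_atoms[OF assms])

text \<open>If an atom \<open>x\<close> exceeds a fixed nonzero element \<open>m\<close>, then
  \<open>x - m\<close> is a gap, since otherwise \<open>x = (x - m) + m\<close> would be a
  splitting; and there are finitely many gaps.\<close>

lemma finite_atoms:
  assumes S: "numerical_semigroup S"
  shows "finite (atoms S)"
proof (cases "atoms S = {}")
  case False
  then obtain m where m: "m \<in> S - {0}" by (auto simp: atoms_def)
  have "atoms S \<subseteq> {..m} \<union> (\<lambda>x. x + m) ` (UNIV - S)"
  proof
    fix x assume x: "x \<in> atoms S"
    show "x \<in> {..m} \<union> (\<lambda>x. x + m) ` (UNIV - S)"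
    proof (cases "x \<le> m")
      case False
      then have e: "x = (x - m) + m" and "x - m \<noteq> 0" by auto
      then have "x - m \<notin> S" using atoms_irreducible[OF x _ m, of "x - m"] by (metis DiffI singletonD)
      then have "(x - m) + m \<in> (\<lambda>x. x + m) ` (UNIV - S)" by blast
      then show ?thesis using e by simp
    qed simp
  qed
  moreover have "finite (UNIV - S)" using S by (simp add: numerical_semigroup_def)
  ultimately show ?thesis by (meson finite_UnI finite_atMost finite_imageI finite_subset)
qed simp

section \<open>The semigroup \<open>\<Delta>\<^sub>d(a)\<close>\<close>

text \<open>Since \<open>d * a + i + d * x = d * (a + x) + i\<close>, the translate with shift
  \<open>i\<close> lies in residue class \<open>i\<close>, and uniqueness of quotient and remainder
  settles each class separately.\<close>

lemma mem_Delta_ext_iff: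
  assumes "i < d"
  shows "d * q + i \<in> Delta_ext \<Delta> d a \<longleftrightarrow> q \<in> (if i = 0 then \<Delta> else translate a \<Delta>)"
proof -
  have uniq: "q = q' \<and> i = j" if "d * q + i = d * q' + j" "j < d" for q' j
  proof -
    have "(d * q + i) div d = (d * q' + j) div d" "(d * q + i) mod d = (d * q' + j) mod d"
      using that by simp_all
    then show ?thesis using assms \<open>j < d\<close> by simp
  qed
  show ?thesis
  proof
    assume "d * q + i \<in> Delta_ext \<Delta> d a"
    \<comment> \<open>The added \<open>0\<close> is the residue; it gives both cases the shape that
      \<open>uniq\<close> expects.\<close>
    then consider x where "x \<in> \<Delta>" "d * q + i = d * x + 0"
      | x j where "x \<in> \<Delta>" "1 \<le> j" "j < d" "d * q + i = d * (a + x) + j"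
      using assms by (fastforce simp: Delta_ext_def dilate_def translate_def algebra_simps)
    then show "q \<in> (if i = 0 then \<Delta> else translate a \<Delta>)"
    proof cases
      case 1 then show ?thesis using uniq[of x 0] assms by auto
    next
      case 2 then show ?thesis using uniq[of "a + x" j] by (auto simp: translate_def)
    qed
  next
    assume q: "q \<in> (if i = 0 then \<Delta> else translate a \<Delta>)"
    show "d * q + i \<in> Delta_ext \<Delta> d a"
    proof (cases "i = 0")
      case True then show ?thesis using q by (auto simp: Delta_ext_def dilate_def)
    next
      case False
      then obtain x where "x \<in> \<Delta>" "q = a + x" using q by (auto simp: translate_def)
      then have "d * q + i \<in> translate (d * a + i) (dilate d \<Delta>)"
        by (force simp: translate_def dilate_def distrib_left)
      then show ?thesis using False assms by (auto simp: Delta_ext_def)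
    qed
  qed
qed

lemma Delta_ext_cases:
  assumes "x \<in> Delta_ext \<Delta> d a"
  obtains (mult) s where "s \<in> \<Delta>" "x = d * s"
  | (shift) s i where "s \<in> \<Delta>" "0 < i" "i < d" "x = d * (a + s) + i"
  using assms by (fastforce simp: Delta_ext_def dilate_def translate_def algebra_simps)

lemma Delta_ext_multI: "s \<in> \<Delta> \<Longrightarrow> d * s \<in> Delta_ext \<Delta> d a"
  by (auto simp: Delta_ext_def dilate_def)

lemma Delta_ext_shiftI:
  "s \<in> \<Delta> \<Longrightarrow> 0 < i \<Longrightarrow> i < d \<Longrightarrow> d * (a + s) + i \<in> Delta_ext \<Delta> d a"
  by (simp add: mem_Delta_ext_iff translate_def)

lemma submonoid_nat_Delta_ext:
  assumes D: "submonoid_nat \<Delta>" and a: "a \<in> \<Delta>" "a + 1 \<in> \<Delta>"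
  shows "submonoid_nat (Delta_ext \<Delta> d a)"
  unfolding submonoid_nat_def
proof (intro conjI ballI)
  note add = submonoid_natD(2)[OF D]
  show "0 \<in> Delta_ext \<Delta> d a"
    using Delta_ext_multI[OF submonoid_natD(1)[OF D], of d a] by simp
  fix x y assume x: "x \<in> Delta_ext \<Delta> d a" and y: "y \<in> Delta_ext \<Delta> d a"
  from x show "x + y \<in> Delta_ext \<Delta> d a"
  proof (cases rule: Delta_ext_cases)
    case mult: (mult s)
    from y show ?thesis
    proof (cases rule: Delta_ext_cases)
      case (mult t)
      then show ?thesis
        using Delta_ext_multI[of "s + t" \<Delta> d a] add \<open>s \<in> \<Delta>\<close> \<open>x = d * s\<close> by (simp add: algebra_simps)
    next
      case (shift t i)
      then show ?thesis
        using Delta_ext_shiftI[of "s + t" \<Delta> i d a] add \<open>s \<in> \<Delta>\<close> \<open>x = d * s\<close> by (simp add: algebra_simps)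
    qed
  next
    case s: (shift s i)
    from y show ?thesis
    proof (cases rule: Delta_ext_cases)
      case (mult t)
      then show ?thesis
        using Delta_ext_shiftI[of "s + t" \<Delta> i d a] add s by (simp add: algebra_simps)
    next
      case t: (shift t j)
      \<comment> \<open>The quotients add up to \<open>2 * a + s + t\<close>, plus one if there is a
        carry. Without a carry this is \<open>a + (a + (s + t))\<close>, with one it is
        \<open>a + ((a + 1) + (s + t))\<close>. For \<open>i + j = d\<close> the residue is 0 and
        the quotient only has to lie in \<Delta>.\<close>
      consider "i + j < d" | "i + j = d" | "d < i + j" by linarith
      then show ?thesis
      proof cases
        case 1
        have "a + (s + t) \<in> \<Delta>" by (rule add[OF a(1) add[OF s(1) t(1)]])
        from Delta_ext_shiftI[OF this, of "i + j" d a] show ?thesis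
          using s t 1 by (simp add: algebra_simps)
      next
        case 2
        have "(a + 1) + (a + (s + t)) \<in> \<Delta>"
          by (rule add[OF a(2) add[OF a(1) add[OF s(1) t(1)]]])
        from Delta_ext_multI[OF this, of d a] show ?thesis
          using s t by (simp add: 2[symmetric] algebra_simps)
      next
        case 3
        then obtain k where k: "i + j = d + k" "0 < k" using less_imp_add_positive by metis
        have "(a + 1) + (s + t) \<in> \<Delta>" by (rule add[OF a(2) add[OF s(1) t(1)]])
        moreover have "k < d" using k s t by simp
        ultimately have "d * (a + ((a + 1) + (s + t))) + k \<in> Delta_ext \<Delta> d a"
          using Delta_ext_shiftI k by blast
        moreover have "d * (a + ((a + 1) + (s + t))) + k = x + y"
          unfolding s(4) t(4) using k(1) by (simp add: algebra_simps)
        ultimately show ?thesis by simp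
      qed
    qed
  qed
qed

section \<open>Gaps, genus and Frobenius number of the extension\<close>

lemma gaps_translate: "UNIV - translate a \<Delta> = {..<a} \<union> (\<lambda>x. a + x) ` (UNIV - \<Delta>)"
proof -
  have "x \<in> (\<lambda>x. a + x) ` (UNIV - \<Delta>) \<or> x \<in> translate a \<Delta>" if "\<not> x < a" for x
  proof -
    have "x = a + (x - a)" using that by simp
    then show ?thesis unfolding translate_def by blast
  qed
  then show ?thesis by (auto simp: translate_def)
qed

lemma gaps_Delta_ext:
  assumes "0 < d"
  shows "UNIV - Delta_ext \<Delta> d a =
    (\<Union>i<d. (\<lambda>q. d * q + i) ` (UNIV - (if i = 0 then \<Delta> else translate a \<Delta>)))" (is "_ = ?R")
proof
  show "?R \<subseteq> UNIV - Delta_ext \<Delta> d a" using mem_Delta_ext_iff by blast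
  show "UNIV - Delta_ext \<Delta> d a \<subseteq> ?R"
  proof
    fix x assume x: "x \<in> UNIV - Delta_ext \<Delta> d a"
    have r: "x mod d < d" and e: "x = d * (x div d) + x mod d" using assms by auto
    have "x div d \<in> UNIV - (if x mod d = 0 then \<Delta> else translate a \<Delta>)"
      using x e mem_Delta_ext_iff[OF r, of "x div d" \<Delta> a] by simp
    then show "x \<in> ?R" using r e by blast
  qed
qed

text \<open>Class 0 contributes one gap for each gap of \<Delta>; each of the other
  \<open>d - 1\<close> classes has \<open>a\<close> more, from the quotients below
  \<open>a\<close>.\<close>

lemma
  assumes fin: "finite (UNIV - \<Delta>)" and d: "0 < d"
  shows finite_gaps_Delta_ext: "finite (UNIV - Delta_ext \<Delta> d a)"
    and genus_Delta_ext: "genus (Delta_ext \<Delta> d a) = d * genus \<Delta> + (d - 1) * a"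
proof -
  define G where "G i = UNIV - (if i = 0 then \<Delta> else translate a \<Delta>)" for i :: nat
  have finG: "finite (G i)" for i using fin by (simp add: G_def gaps_translate)
  have cardG: "card (G i) = genus \<Delta> + (if i = 0 then 0 else a)" for i
  proof (cases "i = 0")
    case False
    have "card ({..<a} \<union> (\<lambda>x. a + x) ` (UNIV - \<Delta>)) = a + genus \<Delta>"
      using fin by (subst card_Un_disjoint) (auto simp: card_image genus_def)
    then show ?thesis using False by (simp add: G_def gaps_translate)
  qed (simp add: G_def genus_def)
  have gaps: "UNIV - Delta_ext \<Delta> d a = (\<Union>i<d. (\<lambda>q. d * q + i) ` G i)"
    unfolding G_def by (rule gaps_Delta_ext[OF d])
  show "finite (UNIV - Delta_ext \<Delta> d a)" unfolding gaps using finG by blast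
  have disj: "(\<lambda>q. d * q + i) ` G i \<inter> (\<lambda>q. d * q + j) ` G j = {}" if "i < d" "j < d" "i \<noteq> j" for i j
  proof -
    have "d * q + i \<noteq> d * q' + j" for q q'
    proof
      assume "d * q + i = d * q' + j"
      then have "(d * q + i) mod d = (d * q' + j) mod d" by simp
      then show False using that by simp
    qed
    then show ?thesis by blast
  qed
  have inj: "inj_on (\<lambda>q. d * q + i) A" for i A using d by (simp add: inj_on_def)
  have "genus (Delta_ext \<Delta> d a) = (\<Sum>i<d. card ((\<lambda>q. d * q + i) ` G i))"
    unfolding genus_def gaps by (rule card_UN_disjoint) (use finG disj in auto)
  also have "\<dots> = (\<Sum>i<d. genus \<Delta> + (if i = 0 then 0 else a))"
    by (simp add: card_image[OF inj] cardG)
  \<comment> \<open>\<open>sum.lessThan_Suc_shift\<close> splits off index 0, the only one in the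
    first branch of the \<open>if\<close>.\<close>
  also have "\<dots> = d * genus \<Delta> + (d - 1) * a"
    using d by (cases d) (simp_all add: sum.distrib sum.lessThan_Suc_shift del: sum.lessThan_Suc)
  finally show "genus (Delta_ext \<Delta> d a) = d * genus \<Delta> + (d - 1) * a" .
qed

text \<open>The largest missing quotient is \<open>f\<close> in class 0 and \<open>f + a\<close> in
  every other class. The top gap therefore has quotient \<open>f + a\<close> and the largest
  residue, which is nonzero because \<open>2 \<le> d\<close>.\<close>

lemma Delta_ext_largest_gap:
  assumes f: "f \<notin> \<Delta>" "\<And>x. f < x \<Longrightarrow> x \<in> \<Delta>" and d: "2 \<le> d"
  shows "d * (f + a) + (d - 1) \<notin> Delta_ext \<Delta> d a"
    and "d * (f + a) + (d - 1) < x \<Longrightarrow> x \<in> Delta_ext \<Delta> d a"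
proof -
  show "d * (f + a) + (d - 1) \<notin> Delta_ext \<Delta> d a"
    using d f(1) mem_Delta_ext_iff[of "d - 1" d "f + a" \<Delta> a] by (auto simp: translate_def)
  assume "d * (f + a) + (d - 1) < x"
  then have "d * (f + a + 1) \<le> x" using d by (simp add: algebra_simps)
  then have q: "f + a < x div d"
    using d by (simp add: less_eq_div_iff_mult_less_eq mult.commute Suc_le_eq[symmetric])
  \<comment> \<open>This serves residue 0; for the other residues \<open>x div d - a\<close> is
    used, which still exceeds \<open>f\<close>.\<close>
  then have "x div d \<in> \<Delta>" using f(2) by simp
  moreover have "x div d - a \<in> \<Delta>" and "x div d = a + (x div d - a)" using q f(2) by auto
  then have "x div d \<in> translate a \<Delta>" unfolding translate_def by blast
  ultimately show "x \<in> Delta_ext \<Delta> d a"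
    using mem_Delta_ext_iff[of "x mod d" d "x div d" \<Delta> a] d by simp
qed

section \<open>Multiplicity, atoms and embedding dimension of the extension\<close>

lemma multiplicity_ns_Delta_ext:
  assumes a: "a \<in> \<Delta> - {0}" and d: "0 < d"
  shows "multiplicity_ns (Delta_ext \<Delta> d a) = d * multiplicity_ns \<Delta>"
proof -
  let ?m = "multiplicity_ns \<Delta>"
  have m: "?m \<in> \<Delta> - {0}" "\<And>x. x \<in> \<Delta> - {0} \<Longrightarrow> ?m \<le> x"
    using multiplicity_ns_mem[of _ \<Delta>] a by blast+
  show ?thesis
    unfolding multiplicity_ns_def[of "Delta_ext \<Delta> d a"]
  proof (rule Least_equality)
    show "d * ?m \<in> Delta_ext \<Delta> d a - {0}" using m(1) d by (auto intro: Delta_ext_multI)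
  next
    fix x assume x: "x \<in> Delta_ext \<Delta> d a - {0}"
    then have "x \<in> Delta_ext \<Delta> d a" by simp
    then show "d * ?m \<le> x"
    proof (cases rule: Delta_ext_cases)
      case (mult s)
      then show ?thesis using x m(2)[of s] by auto
    next
      case (shift s i)
      \<comment> \<open>\<open>a\<close> is itself a nonzero element of \<Delta>, so the
        multiplicity is at most \<open>a\<close>.\<close>
      have "d * ?m \<le> d * (a + s)" using m(2)[OF a] by (intro mult_le_mono) auto
      then show ?thesis using shift by linarith
    qed
  qed
qed

text \<open>In a class \<open>i \<noteq> 0\<close>, everything above \<open>d * a + i\<close> splits
  off a nonzero multiple of \<open>d\<close>. In class 0, a sum of two shifted elements involves a
  carry, and \<open>a + 1 \<in> \<Delta>\<close> turns it into a splitting inside \<Delta>.\<close>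

lemma atoms_Delta_ext:
  assumes D: "submonoid_nat \<Delta>" and a: "a \<in> \<Delta> - {0}" "a + 1 \<in> \<Delta>" and d: "0 < d"
  shows "atoms (Delta_ext \<Delta> d a) = (\<lambda>x. d * x) ` atoms \<Delta> \<union> (\<lambda>i. d * a + i) ` {1..<d}"
    (is "atoms ?E = ?M \<union> ?N")
proof
  have z: "0 \<in> \<Delta>" by (rule submonoid_natD(1)[OF D])
  show "atoms ?E \<subseteq> ?M \<union> ?N"
  proof
    fix x assume x: "x \<in> atoms ?E"
    then have xE: "x \<in> ?E" "x \<noteq> 0"
      and irr: "\<And>y z. y \<in> ?E - {0} \<Longrightarrow> z \<in> ?E - {0} \<Longrightarrow> x \<noteq> y + z"
      by (auto simp: atoms_def)
    from xE(1) show "x \<in> ?M \<union> ?N"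
    proof (cases rule: Delta_ext_cases)
      case (mult s)
      have "s \<noteq> u + v" if "u \<in> \<Delta> - {0}" "v \<in> \<Delta> - {0}" for u v
        using irr[of "d * u" "d * v"] that d mult by (auto simp: Delta_ext_multI algebra_simps)
      then show ?thesis using mult xE by (auto simp: atoms_def)
    next
      case (shift s i)
      \<comment> \<open>The least element of the class is split off; irreducibility forces the other
        summand \<open>d * s\<close> to vanish.\<close>
      have "d * (a + 0) + i \<in> ?E - {0}" using shift z Delta_ext_shiftI[of 0 \<Delta> i d a] by simp
      moreover have "x = (d * (a + 0) + i) + d * s" using shift by (simp add: algebra_simps)
      ultimately have "d * s \<notin> ?E - {0}" using irr by blast
      then have "s = 0" using d Delta_ext_multI[OF shift(1), of d a] by simp
      then show ?thesis using shift by auto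
    qed
  qed
  text \<open>Hence a splitting of \<open>d * a + i\<close> with \<open>i < d\<close> would have both summands in \<open>d\<Delta>\<close>.\<close>
  have big: "d * (a + 1) \<le> y + w" if "y \<in> ?E - {0}" "w \<in> ?E" "w \<notin> (\<lambda>x. d * x) ` \<Delta>" for y w
  proof -
    \<comment> \<open>For shifted elements this bound comes from
      \<open>a \<noteq> 0\<close>.\<close>
    have y: "d \<le> y"
    proof -
      have "y \<in> ?E" using that by simp
      then show ?thesis
      proof (cases rule: Delta_ext_cases)
        case (mult s) then show ?thesis using that by auto
      next
        case (shift s i)
        have "d * 1 \<le> d * (a + s)" using a by (intro mult_le_mono) auto
        then show ?thesis using shift by linarith
      qed
    qed
    from that(2) have "d * a \<le> w"
      using that(3) by (cases rule: Delta_ext_cases) (auto simp: algebra_simps)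
    then show ?thesis using y by (simp add: algebra_simps)
  qed
  have "d * s \<in> atoms ?E" if s: "s \<in> atoms \<Delta>" for s
  proof -
    have sD: "s \<in> \<Delta>" "s \<noteq> 0"
      and irr: "\<And>u v. u \<in> \<Delta> - {0} \<Longrightarrow> v \<in> \<Delta> - {0} \<Longrightarrow> s \<noteq> u + v"
      using s by (auto simp: atoms_def)
    have "d * s \<noteq> y + w" if y: "y \<in> ?E - {0}" and w: "w \<in> ?E - {0}" for y w
    proof
      assume eq: "d * s = y + w"
      have "y \<in> ?E" "w \<in> ?E" using y w by auto
      from this(1) show False
      proof (cases rule: Delta_ext_cases)
        case u: (mult u)
        from \<open>w \<in> ?E\<close> show False
        proof (cases rule: Delta_ext_cases)
          case v: (mult v)
          have "d * s = d * (u + v)" using eq u v by (simp add: algebra_simps)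
          then show False using irr[of u v] u v y w d by auto
        next
          case v: (shift v j)
          \<comment> \<open>With exactly one shifted summand, the sum has that summand's nonzero
            residue.\<close>
          have "d * s mod d = (d * (u + (a + v)) + j) mod d"
            using eq u v by (simp add: algebra_simps)
          then show False using v by simp
        qed
      next
        case u: (shift u i)
        from \<open>w \<in> ?E\<close> show False
        proof (cases rule: Delta_ext_cases)
          case v: (mult v)
          have "d * s mod d = (d * (a + u + v) + i) mod d"
            using eq u v by (simp add: algebra_simps)
          then show False using u by simp
        next
          case v: (shift v j)
          have e: "d * s = d * (a + u + (a + v)) + (i + j)" using eq u v by (simp add: algebra_simps)
          \<comment> \<open>A multiple of \<open>d\<close> strictly between 0 and
            \<open>2 * d\<close> can only be \<open>d\<close>.\<close>
          then have "d dvd i + j" by (metis dvd_add_right_iff dvd_triv_left)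
          then obtain k where k: "i + j = d * k" ..
          have "0 < k" "k < 2"
          proof -
            show "0 < k" using k u by (cases k) auto
            have "d * k < d * 2" unfolding k[symmetric] using u(3) v(3) by linarith
            then show "k < 2" by simp
          qed
          then have "i + j = d" using k by (cases "k = 1") auto
          \<comment> \<open>The carry is given to the second summand, where
            \<open>a + 1 \<in> \<Delta>\<close> applies; \<open>a \<noteq> 0\<close> keeps the first
            summand nonzero.\<close>
          then have "d * s = d * ((a + u) + ((a + 1) + v))" using e by (simp add: algebra_simps)
          then have "s = (a + u) + ((a + 1) + v)" using d by (simp only: mult_cancel1) simp
          moreover have "a + u \<in> \<Delta> - {0}" "(a + 1) + v \<in> \<Delta> - {0}"
            using submonoid_natD(2)[OF D _ u(1), of a] submonoid_natD(2)[OF D a(2) v(1)] a by auto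
          ultimately show False using irr by blast
        qed
      qed
    qed
    then show ?thesis using sD d by (auto simp: atoms_def Delta_ext_multI)
  qed
  moreover have "d * a + i \<in> atoms ?E" if i: "0 < i" "i < d" for i
  proof -
    have mem: "d * a + i \<in> ?E" using Delta_ext_shiftI[OF z i, of a] by simp
    have "d * a + i \<noteq> y + w" if y: "y \<in> ?E - {0}" and w: "w \<in> ?E - {0}" for y w
    proof
      assume eq: "d * a + i = y + w"
      then have small: "y + w < d * (a + 1)" using i by (simp add: algebra_simps)
      have "y \<in> (\<lambda>x. d * x) ` \<Delta>" using big[of w y] y w small by fastforce
      moreover have "w \<in> (\<lambda>x. d * x) ` \<Delta>" using big[of y w] y w small by fastforce
      ultimately have "d dvd d * a + i" unfolding eq by auto
      then have "d dvd i" by (simp add: dvd_add_right_iff)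
      then show False using i nat_dvd_not_less by blast
    qed
    then show ?thesis using mem i by (auto simp: atoms_def)
  qed
  ultimately show "?M \<union> ?N \<subseteq> atoms ?E" by (force simp del: image_add_atLeastLessThan)
qed

text \<open>The \<open>d - 1\<close> new atoms are not multiples of \<open>d\<close>, so they are
  disjoint from the scaled atoms of \<Delta>, and the cardinalities add.\<close>

lemma embedding_dim_Delta_ext:
  assumes ns: "numerical_semigroup \<Delta>" and a: "a \<in> \<Delta> - {0}" "a + 1 \<in> \<Delta>" and d: "0 < d"
  shows "embedding_dim (Delta_ext \<Delta> d a) = embedding_dim \<Delta> + d - 1"
proof -
  have D: "submonoid_nat \<Delta>" using ns by (simp add: numerical_semigroup_def)
  have E: "submonoid_nat (Delta_ext \<Delta> d a)" using submonoid_nat_Delta_ext D a by simp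
  have "\<not> d dvd d * a + i" if "i \<in> {1..<d}" for i
    using that nat_dvd_not_less[of i d] by (simp add: dvd_add_right_iff)
  then have disj: "(\<lambda>x. d * x) ` atoms \<Delta> \<inter> (\<lambda>i. d * a + i) ` {1..<d} = {}"
    by (metis (no_types, lifting) disjoint_iff dvd_triv_left imageE)
  have "card (atoms (Delta_ext \<Delta> d a)) =
      card ((\<lambda>x. d * x) ` atoms \<Delta>) + card ((\<lambda>i. d * a + i) ` {1..<d})"
    unfolding atoms_Delta_ext[OF D a d]
    by (rule card_Un_disjoint) (use finite_atoms[OF ns] disj in auto)
  also have "\<dots> = card (atoms \<Delta>) + (d - 1)"
    using d by (simp add: card_image inj_on_def)
  finally show ?thesis
    using d by (simp add: embedding_dim_eq_card_atoms D E)
qed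

theorem theorem3p4:
  fixes \<Delta> :: "nat set" and d a :: nat
  assumes "numerical_semigroup \<Delta>"
    and "\<Delta> \<noteq> UNIV"
    and "d \<ge> 2"
    and "a \<in> \<Delta> - {0}"
    and "a + 1 \<in> \<Delta>"
  shows "numerical_semigroup (Delta_ext \<Delta> d a)
    \<and> multiplicity_ns (Delta_ext \<Delta> d a) = d * multiplicity_ns \<Delta>
    \<and> frobenius (Delta_ext \<Delta> d a) = int d * frobenius \<Delta> + int d * int a + int d - 1
    \<and> genus (Delta_ext \<Delta> d a) = d * genus \<Delta> + (d - 1) * a
    \<and> n_small (Delta_ext \<Delta> d a) = d * n_small \<Delta> + a
    \<and> embedding_dim (Delta_ext \<Delta> d a) = embedding_dim \<Delta> + d - 1"
proof -
  let ?E = "Delta_ext \<Delta> d a"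
  have D: "submonoid_nat \<Delta>" and fin: "finite (UNIV - \<Delta>)" and d: "0 < d"
    using assms by (auto simp: numerical_semigroup_def)
  have ns: "numerical_semigroup ?E"
    using submonoid_nat_Delta_ext[OF D] finite_gaps_Delta_ext[OF fin d] assms
    by (simp add: numerical_semigroup_def)
  obtain f where f: "f \<notin> \<Delta>" "\<And>x. f < x \<Longrightarrow> x \<in> \<Delta>"
    using numerical_semigroup_largest_gap assms(1,2) by blast
  note fE = Delta_ext_largest_gap[OF f \<open>d \<ge> 2\<close>]
  have frob: "frobenius ?E = int d * frobenius \<Delta> + int d * int a + int d - 1"
    using frobenius_eqI[OF f] frobenius_eqI[OF fE, of a] d by (simp add: algebra_simps of_nat_diff)
  have genus: "genus ?E = d * genus \<Delta> + (d - 1) * a"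
    by (rule genus_Delta_ext[OF fin d])
  \<comment> \<open>The right-hand side is \<open>d * (f + a) + (d - 1) + 1\<close>, regrouped so
    that \<open>f + 1\<close> can be replaced by the same identity for \<Delta>.\<close>
  have "n_small ?E + genus ?E = d * (f + 1) + d * a"
    using n_small_plus_genus[OF fE, of a] d by (simp add: algebra_simps)
  \<comment> \<open>Writing \<open>d * a\<close> as \<open>(d - 1) * a + a\<close> exposes the genus
    of the extension, which then cancels.\<close>
  also have "\<dots> = d * n_small \<Delta> + d * genus \<Delta> + ((d - 1) * a + a)"
    using d by (cases d) (simp_all only: n_small_plus_genus[OF f, symmetric] distrib_left, simp_all)
  finally have n: "n_small ?E = d * n_small \<Delta> + a" using genus by simp
  show ?thesis
    using ns frob genus n multiplicity_ns_Delta_ext[OF \<open>a \<in> \<Delta> - {0}\<close> d]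
      embedding_dim_Delta_ext[OF assms(1,4,5) d] by blast
qed

end
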